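(* Let $M$ be a positive measure on $\mathbb{R}$ with moments of all orders, and suppose that $M$ is indeterminate. Let $A$ be the densely defined operator from $\ell^2=\ell^2(\mathbb{Z}_+)$ to $L^2(M)$ with domain $\mathcal{D}$ given by $Ag(x)=\sum_{n\ge 0} g_n x^n$ for $g=(g_0,g_1,\ldots)\in\mathcal{D}$. Then $A$ is closable.
   Context: $\ell^2=\ell^2(\mathbb{Z}_+)$ is the Hilbert space of square-summable complex sequences indexed by $n=0,1,2,\ldots$, and $\mathcal{D}\subset\ell^2$ is the dense subspace of complex sequences with only finitely many non-zero terms. $M$ has moments of all orders if $\mathbb{C}[x]\subset L^2(M)$, equivalently all moments $q_n=\int_{-\infty}^\infty x^n\,dM(x)$, $n\ge 0$, are well defined with absolutely convergent integrals. $M$ is called determinate if it is the only positive measure on $\mathbb{R}$ with the moments $q_n$, $n\ge 0$, and indeterminate otherwise. An operator $A:\mathcal{D}\to L^2(M)$ is closable if whenever $g^{(n)}\in\mathcal{D}$, $g^{(n)}\to 0$ in $\ell^2$ and $Ag^{(n)}\to f$ in $L^2(M)$, then $f=0$. *)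

theory Defs
  imports "HOL-Analysis.Analysis" "HOL-Computational_Algebra.Polynomial"
begin

definition ell2 :: "(nat \<Rightarrow> complex) set" where
  "ell2 = {g. summable (\<lambda>n. (norm (g n))\<^sup>2)}"

definition ell2_norm :: "(nat \<Rightarrow> complex) \<Rightarrow> real" where
  "ell2_norm g = sqrt (\<Sum>n. (norm (g n))\<^sup>2)"

definition fin_seqs :: "(nat \<Rightarrow> complex) set" where
  "fin_seqs = {g. finite {n. g n \<noteq> 0}}"

text \<open>Elements of $L^2(M)$ are represented by square-integrable functions; equality in $L^2(M)$
  is therefore equality almost everywhere.\<close>

definition L2 :: "real measure \<Rightarrow> (real \<Rightarrow> complex) set" where
  "L2 M = {f \<in> borel_measurable M. integrable M (\<lambda>x. (norm (f x))\<^sup>2)}"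

definition L2_norm :: "real measure \<Rightarrow> (real \<Rightarrow> complex) \<Rightarrow> real" where
  "L2_norm M f = sqrt (LINT x|M. (norm (f x))\<^sup>2)"

definition borel_measure_on_reals :: "real measure \<Rightarrow> bool" where
  "borel_measure_on_reals M \<longleftrightarrow> sets M = sets borel"

definition moments_all_orders :: "real measure \<Rightarrow> bool" where
  "moments_all_orders M \<longleftrightarrow> (\<forall>p :: complex poly. (\<lambda>x. poly p (complex_of_real x)) \<in> L2 M)"

definition moment :: "real measure \<Rightarrow> nat \<Rightarrow> real" where
  "moment M n = (LINT x|M. x ^ n)"

text \<open>In \<open>determinate\<close>, \<open>has_bochner_integral\<close> says that the $n$-th moment integral of the
  competitor $N$ converges absolutely and has the stated value.\<close>

definition determinate :: "real measure \<Rightarrow> bool" where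
  "determinate M \<longleftrightarrow>
     (\<forall>N. borel_measure_on_reals N \<and> (\<forall>n. has_bochner_integral N (\<lambda>x. x ^ n) (moment M n))
          \<longrightarrow> N = M)"

definition indeterminate :: "real measure \<Rightarrow> bool" where
  "indeterminate M \<longleftrightarrow> \<not> determinate M"

text \<open>The series below is a finite sum for \<open>g \<in> fin_seqs\<close>, the domain of the operator; its
  values at other sequences play no role.\<close>

definition power_series_op :: "(nat \<Rightarrow> complex) \<Rightarrow> real \<Rightarrow> complex" where
  "power_series_op g x = (\<Sum>n. g n * complex_of_real x ^ n)"

definition closable ::
    "(nat \<Rightarrow> complex) set \<Rightarrow> real measure \<Rightarrow> ((nat \<Rightarrow> complex) \<Rightarrow> real \<Rightarrow> complex) \<Rightarrow> bool" where
  "closable D M A \<longleftrightarrow>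
     (\<forall>g f. (\<forall>k. g k \<in> D) \<and> f \<in> L2 M
        \<and> (\<lambda>k. ell2_norm (g k)) \<longlonglongrightarrow> 0
        \<and> (\<lambda>k. L2_norm M (\<lambda>x. A (g k) x - f x)) \<longlonglongrightarrow> 0
        \<longrightarrow> (AE x in M. f x = 0))"

text \<open>Sanity checks: the square-integrability of all polynomials is the absolute convergence of
  all moment integrals, and \<open>power_series_op\<close> is a densely defined linear operator from
  \<open>ell2\<close> to \<open>L2 M\<close> with domain \<open>fin_seqs\<close>.\<close>

lemma moments_all_orders_iff_integrable:
  assumes M: "borel_measure_on_reals M"
  shows "moments_all_orders M \<longleftrightarrow> (\<forall>n. integrable M (\<lambda>x. x ^ n))"
proof -
  have sM [measurable_cong]: "sets M = sets borel"
    using M by (simp add: borel_measure_on_reals_def)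
  show ?thesis
  proof
    assume L: "moments_all_orders M"
    have sq: "integrable M (\<lambda>x. (x ^ n)\<^sup>2)" for n
    proof -
      have "(\<lambda>x. poly (monom 1 n) (complex_of_real x)) \<in> L2 M"
        using L unfolding moments_all_orders_def by blast
      moreover have "(norm (poly (monom 1 n) (complex_of_real x)))\<^sup>2 = (x ^ n)\<^sup>2" for x
        by (simp only: poly_monom norm_mult norm_power norm_of_real norm_one mult_1
            power_abs[symmetric] power2_abs abs_power2)
      ultimately show ?thesis by (simp only: L2_def mem_Collect_eq)
    qed
    show "\<forall>n. integrable M (\<lambda>x. x ^ n)"
    proof
      fix n
      have i: "integrable M (\<lambda>x. (x ^ 0)\<^sup>2 + (x ^ n)\<^sup>2)"
        by (intro Bochner_Integration.integrable_add sq)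
      show "integrable M (\<lambda>x. x ^ n)"
      proof (rule Bochner_Integration.integrable_bound[OF i])
        show "AE x in M. norm (x ^ n) \<le> norm ((x ^ 0)\<^sup>2 + (x ^ n)\<^sup>2)"
        proof (rule AE_I2)
          fix x :: real
          have "\<bar>y\<bar> \<le> 1 + y\<^sup>2" for y :: real
            using zero_le_power2[of "\<bar>y\<bar> - 1"] abs_ge_zero[of y] by (simp add: power2_diff)
          from this[of "x ^ n"]
          show "norm (x ^ n) \<le> norm ((x ^ 0)\<^sup>2 + (x ^ n)\<^sup>2)" by simp
        qed
      qed measurable
    qed
  next
    assume I: "\<forall>n. integrable M (\<lambda>x. x ^ n)"
    show "moments_all_orders M"
      unfolding moments_all_orders_def
    proof
      fix p :: "complex poly"
      let ?f = "\<lambda>x. poly p (complex_of_real x)"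
      have meas: "?f \<in> borel_measurable M"
        unfolding poly_altdef by measurable
      have eq: "(norm (?f x))\<^sup>2 =
          Re (\<Sum>i\<le>degree p. \<Sum>j\<le>degree p. coeff p i * cnj (coeff p j) * complex_of_real (x ^ (i + j)))"
        for x
      proof -
        have "complex_of_real ((norm (?f x))\<^sup>2) = ?f x * cnj (?f x)"
          by (rule complex_norm_square)
        also have "cnj (?f x) = (\<Sum>j\<le>degree p. cnj (coeff p j) * complex_of_real x ^ j)"
          by (simp add: poly_altdef)
        also have "?f x * \<dots> = (\<Sum>i\<le>degree p. \<Sum>j\<le>degree p.
            (coeff p i * complex_of_real x ^ i) * (cnj (coeff p j) * complex_of_real x ^ j))"
          unfolding poly_altdef sum_product ..
        also have "\<dots> = (\<Sum>i\<le>degree p. \<Sum>j\<le>degree p.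
            coeff p i * cnj (coeff p j) * complex_of_real (x ^ (i + j)))"
          by (intro sum.cong refl) (simp add: power_add)
        finally show ?thesis by (metis Re_complex_of_real)
      qed
      have "integrable M (\<lambda>x. (norm (?f x))\<^sup>2)"
        unfolding eq
        by (intro integrable_Re Bochner_Integration.integrable_sum integrable_mult_right
            integrable_of_real) (use I in auto)
      with meas show "?f \<in> L2 M" by (simp add: L2_def)
    qed
  qed
qed

lemma power_series_op_eq_sum:
  assumes "g \<in> fin_seqs"
  shows "power_series_op g x = (\<Sum>n | g n \<noteq> 0. g n * complex_of_real x ^ n)"
  unfolding power_series_op_def
  by (rule suminf_finite) (use assms in \<open>auto simp: fin_seqs_def\<close>)

lemma power_series_op_eq_poly:
  assumes "g \<in> fin_seqs"
  shows "power_series_op g x = poly (Abs_poly g) (complex_of_real x)"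
proof -
  have c: "coeff (Abs_poly g) = g"
    using assms by (intro Abs_poly_inverse) (simp add: fin_seqs_def MOST_iff_cofinite)
  have "power_series_op g x = (\<Sum>n\<le>degree (Abs_poly g). g n * complex_of_real x ^ n)"
    unfolding power_series_op_def
    proof (rule suminf_finite)
    fix n assume "n \<notin> {..degree (Abs_poly g)}"
    then have "coeff (Abs_poly g) n = 0" by (simp add: coeff_eq_0)
    then show "g n * complex_of_real x ^ n = 0" by (simp add: c)
  qed simp
  then show ?thesis by (simp add: poly_altdef c)
qed

lemma power_series_op_in_L2:
  assumes "moments_all_orders M" "g \<in> fin_seqs"
  shows "power_series_op g \<in> L2 M"
proof -
  have "power_series_op g = (\<lambda>x. poly (Abs_poly g) (complex_of_real x))"
    using power_series_op_eq_poly[OF assms(2)] by blast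
  then show ?thesis using assms(1) by (simp add: moments_all_orders_def)
qed

lemma power_series_op_linear:
  assumes g: "g \<in> fin_seqs" and h: "h \<in> fin_seqs"
  shows "(\<lambda>n. a * g n + b * h n) \<in> fin_seqs"
    and "power_series_op (\<lambda>n. a * g n + b * h n) x = a * power_series_op g x + b * power_series_op h x"
proof -
  show "(\<lambda>n. a * g n + b * h n) \<in> fin_seqs"
    unfolding fin_seqs_def mem_Collect_eq
    by (rule finite_subset[of _ "{n. g n \<noteq> 0} \<union> {n. h n \<noteq> 0}"])
      (use g h in \<open>auto simp: fin_seqs_def\<close>)
  have s: "summable (\<lambda>n. k n * complex_of_real x ^ n)" if "k \<in> fin_seqs" for k
    by (rule summable_finite[of "{n. k n \<noteq> 0}"]) (use that in \<open>auto simp: fin_seqs_def\<close>)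
  show "power_series_op (\<lambda>n. a * g n + b * h n) x = a * power_series_op g x + b * power_series_op h x"
  proof -
    have "power_series_op (\<lambda>n. a * g n + b * h n) x =
        (\<Sum>n. a * (g n * complex_of_real x ^ n) + b * (h n * complex_of_real x ^ n))"
      unfolding power_series_op_def by (simp only: distrib_right mult.assoc)
    also have "\<dots> = (\<Sum>n. a * (g n * complex_of_real x ^ n)) +
        (\<Sum>n. b * (h n * complex_of_real x ^ n))"
      by (rule suminf_add[symmetric]; rule summable_mult; rule s; rule g h)
    also have "\<dots> = a * power_series_op g x + b * power_series_op h x"
      unfolding power_series_op_def suminf_mult[OF s[OF g]] suminf_mult[OF s[OF h]] ..
    finally show ?thesis .
  qed
qed

lemma fin_seqs_subset_ell2: "fin_seqs \<subseteq> ell2"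
proof
  fix g assume "g \<in> fin_seqs"
  then have "finite {n. g n \<noteq> 0}" by (simp add: fin_seqs_def)
  then have "summable (\<lambda>n. (norm (g n))\<^sup>2)"
    by (rule summable_finite) simp
  then show "g \<in> ell2" by (simp add: ell2_def)
qed

lemma fin_seqs_dense:
  assumes g: "g \<in> ell2" and e: "e > 0"
  shows "\<exists>h\<in>fin_seqs. ell2_norm (\<lambda>n. g n - h n) < e"
proof -
  have s: "summable (\<lambda>n. (norm (g n))\<^sup>2)" using g by (simp add: ell2_def)
  from suminf_exist_split[OF _ s, of "e\<^sup>2"] e
  obtain N where N: "norm (\<Sum>i. (norm (g (i + N)))\<^sup>2) < e\<^sup>2" by fastforce
  let ?h = "\<lambda>n. if n < N then g n else 0"
  have h: "?h \<in> fin_seqs"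
    unfolding fin_seqs_def mem_Collect_eq by (rule finite_subset[of _ "{..<N}"]) auto
  let ?d = "\<lambda>n. (norm (g n - ?h n))\<^sup>2"
  have "summable ?d" by (rule summable_comparison_test'[OF s]) auto
  then have "suminf ?d = (\<Sum>i. ?d (i + N)) + (\<Sum>i<N. ?d i)" by (rule suminf_split_initial_segment)
  also have "\<dots> = (\<Sum>i. (norm (g (i + N)))\<^sup>2)" by simp
  finally have "suminf ?d < e\<^sup>2" using N by simp
  then have "ell2_norm (\<lambda>n. g n - ?h n) < e"
    unfolding ell2_norm_def using e real_sqrt_less_iff[of "suminf ?d" "e\<^sup>2"] by simp
  then show ?thesis using h by (intro bexI[of _ "?h"])
qed

end

theory Submission
  imports Defs "HOL-Computational_Algebra.Fundamental_Theorem_Algebra" "HOL-Complex_Analysis.Complex_Analysis"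
begin

text \<open>Let \<open>N \<noteq> M\<close> have the same moments as \<open>M\<close>. The difference \<open>D\<close> of the two Stieltjes transforms is
  holomorphic and not identically zero on the upper half-plane, and \<open>p(z) D(z)\<close> is bounded, for
  each non-real \<open>z\<close>, uniformly over polynomials \<open>p\<close> from a bounded subset of \<open>L\<^sup>2(M)\<close>. As \<open>D\<close> has only
  countably many zeros, some horizontal line carries none, so \<open>p\<close> is bounded on compact pieces of
  that line. Reflecting the roots of \<open>p\<close> into the lower half-plane changes neither \<open>|p|\<close> on the real
  axis nor, hence, its norm, while \<open>|p(x + iy)|\<close> becomes increasing in \<open>y \<ge> 0\<close>; therefore \<open>p\<close> is
  bounded on every disc around the origin. Cauchy's estimate now shows that a bounded sequence in
  \<open>L\<^sup>2(M)\<close> of polynomials whose coefficients tend to zero tends to zero pointwise, and by Fatou's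
  lemma its limit in \<open>L\<^sup>2(M)\<close>, if there is one, is zero.\<close>

section \<open>The Stieltjes transform and its holomorphy in the upper half-plane\<close>

definition stieltjes :: "real measure \<Rightarrow> complex \<Rightarrow> complex" where
  "stieltjes M z = (LINT x|M. 1 / (complex_of_real x - z))"

lemma norm_of_real_diff_ge_Im: "\<bar>Im z\<bar> \<le> norm (complex_of_real x - z)"
  using abs_Im_le_cmod[of "complex_of_real x - z"] by simp

lemma stieltjes_kernel_bound:
  assumes "Im z \<noteq> 0"
  shows "norm (1 / (complex_of_real x - z)) \<le> 1 / \<bar>Im z\<bar>"
proof -
  have "\<bar>Im z\<bar> > 0" using assms by simp
  then show ?thesis
    unfolding norm_divide norm_one using norm_of_real_diff_ge_Im[of z x] by (intro frac_le) auto
qed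

text \<open>The power \<open>k = 1\<close> serves the transform itself, \<open>k = 2\<close> its
  derivative.\<close>

lemma stieltjes_kernel_power_integrable:
  fixes M :: "real measure"
  assumes "finite_measure M" "sets M = sets borel" "Im z \<noteq> 0"
  shows "integrable M (\<lambda>x. (1 / (complex_of_real x - z)) ^ k)"
proof -
  note assms(2)[measurable_cong]
  show ?thesis
  proof (rule finite_measure.integrable_const_bound[OF assms(1)])
    show "AE x in M. norm ((1 / (complex_of_real x - z)) ^ k) \<le> (1 / \<bar>Im z\<bar>) ^ k"
      by (intro AE_I2) (simp only: norm_power power_mono stieltjes_kernel_bound[OF assms(3)] norm_ge_zero)
  qed measurable
qed

lemmas stieltjes_kernel_integrable = stieltjes_kernel_power_integrable[where k = 1, simplified power_one_right]

text \<open>By the resolvent identity, the difference quotient minus the candidate derivative is the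
  integral of \<open>(w - z) * (?k w x * (?k z x) ^ 2)\<close>. Near \<open>z\<close> the kernels
  are bounded uniformly in \<open>x\<close>, so the finite mass makes this error of order |w -
  z|.\<close>

lemma stieltjes_has_field_derivative:
  assumes fin: "finite_measure M" and sets: "sets M = sets borel" and z: "Im z \<noteq> 0"
  shows "(stieltjes M has_field_derivative (LINT x|M. (1 / (complex_of_real x - z)) ^ 2)) (at z)"
proof -
  note sets[measurable_cong]
  define d where "d = \<bar>Im z\<bar>"
  define T where "T = measure M (space M)"
  have d: "d > 0" using z by (simp add: d_def)
  let ?k = "\<lambda>w x. 1 / (complex_of_real x - w)"
  let ?D = "LINT x|M. (?k z x) ^ 2"
  have est: "norm ((stieltjes M w - stieltjes M z) / (w - z) - ?D) \<le> norm (w - z) * (T * (2 / d ^ 3))"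
    if w: "w \<noteq> z" "dist w z < d / 2" for w
  proof -
    \<comment> \<open>Staying within \<open>d / 2\<close> of \<open>z\<close> keeps |Im w| at least
      \<open>d / 2\<close>; this gives the bound \<open>2 / d\<close> for the kernel at
      \<open>w\<close> and hence the constant \<open>2 / d ^ 3\<close>.\<close>
    have "\<bar>Im z\<bar> - \<bar>Im w\<bar> \<le> norm (w - z)"
      using abs_Im_le_cmod[of "w - z"] by simp
    then have Imw: "\<bar>Im w\<bar> \<ge> d / 2" using w by (simp add: dist_norm d_def)
    then have Imw0: "Im w \<noteq> 0" using d by auto
    have ne: "complex_of_real x \<noteq> w" "complex_of_real x \<noteq> z" for x
      using Imw0 z by auto
    have kw: "norm (?k w x) \<le> 2 / d" for x
    proof -
      have "1 / \<bar>Im w\<bar> \<le> 1 / (d / 2)" using Imw d by (intro divide_left_mono mult_pos_pos) auto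
      with stieltjes_kernel_bound[OF Imw0, of x] show ?thesis by simp
    qed
    have kz: "norm (?k z x) \<le> 1 / d" for x
      using stieltjes_kernel_bound[OF z, of x] by (simp add: d_def)
    note ints = stieltjes_kernel_integrable[OF fin sets Imw0] stieltjes_kernel_integrable[OF fin sets z]
      stieltjes_kernel_power_integrable[OF fin sets z, of 2]
    have "(stieltjes M w - stieltjes M z) / (w - z) - ?D
        = (LINT x|M. (?k w x - ?k z x) / (w - z) - (?k z x) ^ 2)"
      unfolding stieltjes_def using ints by simp
    also have "\<dots> = (LINT x|M. (w - z) * (?k w x * (?k z x) ^ 2))"
    proof (rule Bochner_Integration.integral_cong[OF refl])
      fix x
      have "?k w x - ?k z x = (w - z) * (?k w x * ?k z x)"
        using ne[of x] by (simp add: divide_simps)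
      \<comment> \<open>The resolvent identity is used twice: it turns the quotient into
        \<open>u * v\<close>, and then \<open>u * v - v ^ 2 = v * (u - v)\<close> yields another
        factor \<open>w - z\<close>.\<close>
      moreover have "(u - v) / (w - z) - v ^ 2 = (w - z) * (u * v ^ 2)"
        if "u - v = (w - z) * (u * v)" for u v
      proof -
        have "(u - v) / (w - z) = u * v"
          using w(1) that by simp
        then have "(u - v) / (w - z) - v ^ 2 = v * (u - v)"
          by (simp add: power2_eq_square algebra_simps)
        then show ?thesis unfolding that by (simp add: power2_eq_square)
      qed
      ultimately show "(?k w x - ?k z x) / (w - z) - (?k z x) ^ 2 = (w - z) * (?k w x * (?k z x) ^ 2)"
        by blast
    qed
    also have "\<dots> = (w - z) * (LINT x|M. ?k w x * (?k z x) ^ 2)"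
      by (rule integral_mult_right_zero)
    also have "norm \<dots> = norm (w - z) * norm (LINT x|M. ?k w x * (?k z x) ^ 2)"
      unfolding norm_mult ..
    also have "\<dots> \<le> norm (w - z) * (T * (2 / d ^ 3))"
    proof (rule mult_left_mono)
      have b: "norm (?k w x * (?k z x) ^ 2) \<le> 2 / d ^ 3" for x
      proof -
        have "norm (?k w x * (?k z x) ^ 2) \<le> (2 / d) * (1 / d) ^ 2"
          unfolding norm_mult norm_power
          using kw[of x] kz[of x] d by (intro mult_mono power_mono) auto
        then show ?thesis by (simp add: power_divide power3_eq_cube power2_eq_square)
      qed
      have "norm (LINT x|M. ?k w x * (?k z x) ^ 2) \<le> (LINT x|M. norm (?k w x * (?k z x) ^ 2))"
        by (rule integral_norm_bound)
      also have "\<dots> \<le> (LINT x|M. 2 / d ^ 3)"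
        using b by (intro integral_mono integrable_norm finite_measure.integrable_const_bound[OF fin, of _ "2 / d ^ 3"]
              finite_measure.integrable_const[OF fin] AE_I2) measurable
      finally show "norm (LINT x|M. ?k w x * (?k z x) ^ 2) \<le> T * (2 / d ^ 3)"
        by (simp add: T_def)
    qed simp
    finally show ?thesis .
  qed
  have "((\<lambda>w. (stieltjes M w - stieltjes M z) / (w - z) - ?D) \<longlongrightarrow> 0) (at z)"
  proof (rule Lim_null_comparison)
    show "\<forall>\<^sub>F w in at z. norm ((stieltjes M w - stieltjes M z) / (w - z) - ?D) \<le> norm (w - z) * (T * (2 / d ^ 3))"
      unfolding eventually_at using est d by (intro exI[of _ "d / 2"]) auto
    have "((\<lambda>w. norm (w - z) * (T * (2 / d ^ 3))) \<longlongrightarrow> norm (z - z) * (T * (2 / d ^ 3))) (at z)"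
      by (intro tendsto_intros)
    then show "((\<lambda>w. norm (w - z) * (T * (2 / d ^ 3))) \<longlongrightarrow> 0) (at z)" by simp
  qed
  then show ?thesis
    unfolding has_field_derivative_iff using Lim_null by blast
qed

lemma stieltjes_holomorphic_on_upper_half_plane:
  assumes "finite_measure M" "sets M = sets borel"
  shows "stieltjes M holomorphic_on {z. Im z > 0}"
proof (subst holomorphic_on_open)
  show "open {z. Im z > 0}" by (rule open_halfspace_Im_gt)
  show "\<forall>z\<in>{z. Im z > 0}. \<exists>f'. (stieltjes M has_field_derivative f') (at z)"
    using stieltjes_has_field_derivative[OF assms] by (metis less_irrefl mem_Collect_eq)
qed

section \<open>Stieltjes inversion and uniqueness\<close>

lemma Im_stieltjes:
  assumes "finite_measure M" "sets M = sets borel" "e > 0"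
  shows "Im (stieltjes M (Complex s e)) = (LINT x|M. e / ((x - s)\<^sup>2 + e\<^sup>2))"
proof -
  have i: "integrable M (\<lambda>x. 1 / (complex_of_real x - Complex s e))"
    using assms by (intro stieltjes_kernel_integrable) auto
  have "Im (1 / (complex_of_real x - Complex s e)) = e / ((x - s)\<^sup>2 + e\<^sup>2)" for x
    by (simp add: Im_divide)
  then show ?thesis
    unfolding stieltjes_def integral_Im[OF i, symmetric] by simp
qed

text \<open>The integrand is pi times the Poisson kernel of the upper half-plane at height
  \<open>e\<close>; as a function of \<open>s\<close> it has the antiderivative
  \<open>arctan ((s - x) / e)\<close>.\<close>

lemma poisson_kernel_integral:
  fixes a b e x :: real
  assumes "a \<le> b" "e > 0"
  shows "(LBINT s. e / ((x - s)\<^sup>2 + e\<^sup>2) * indicator {a..b} s) = arctan ((b - x) / e) - arctan ((a - x) / e)"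
proof (rule integral_FTC_Icc_real[OF assms(1)])
  fix s
  have "inverse (1 + ((s - x) / e)\<^sup>2) * (1 / e) = e / ((x - s)\<^sup>2 + e\<^sup>2)"
  proof -
    have "1 + ((s - x) / e)\<^sup>2 = ((x - s)\<^sup>2 + e\<^sup>2) / e\<^sup>2"
      using assms by (simp add: power_divide add_divide_distrib power2_commute)
    then show ?thesis using assms by (simp add: power2_eq_square)
  qed
  moreover have "((\<lambda>s. arctan ((s - x) / e)) has_real_derivative inverse (1 + ((s - x) / e)\<^sup>2) * (1 / e)) (at s)"
    using assms by (intro DERIV_arctan[THEN DERIV_chain2]) (auto intro!: derivative_eq_intros)
  ultimately show "((\<lambda>s. arctan ((s - x) / e)) has_real_derivative e / ((x - s)\<^sup>2 + e\<^sup>2)) (at s)"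
    by simp
  have "(x - s)\<^sup>2 + e\<^sup>2 \<noteq> 0" using assms by (auto simp: sum_power2_eq_zero_iff)
  then show "isCont (\<lambda>s. e / ((x - s)\<^sup>2 + e\<^sup>2)) s"
    by (intro continuous_intros)
qed

text \<open>Fubini applies because the kernel is at most \<open>1 / e\<close> and vanishes outside a
  strip of finite product measure.\<close>

lemma integral_Im_stieltjes:
  assumes fin: "finite_measure M" and sets: "sets M = sets borel" and "e > 0" "a \<le> b"
  shows "(LBINT s. Im (stieltjes M (Complex s e)) * indicator {a..b} s)
    = (LINT x|M. arctan ((b - x) / e) - arctan ((a - x) / e))"
proof -
  note sets[measurable_cong]
  interpret finite_measure M by fact
  interpret P: pair_sigma_finite M lborel ..
  have b: "\<bar>e / ((x - s)\<^sup>2 + e\<^sup>2)\<bar> \<le> 1 / e" for x s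
  proof -
    have "e / ((x - s)\<^sup>2 + e\<^sup>2) \<le> e / e\<^sup>2"
      using \<open>e > 0\<close> by (intro divide_left_mono mult_pos_pos add_nonneg_pos) auto
    then show ?thesis using \<open>e > 0\<close> by (simp add: power2_eq_square)
  qed
  have "(LBINT s. Im (stieltjes M (Complex s e)) * indicator {a..b} s)
      = (LBINT s. (LINT x|M. e / ((x - s)\<^sup>2 + e\<^sup>2) * indicator {a..b} s))"
    unfolding Im_stieltjes[OF fin sets \<open>e > 0\<close>] integral_mult_left_zero ..
  also have "\<dots> = (LINT x|M. (LBINT s. e / ((x - s)\<^sup>2 + e\<^sup>2) * indicator {a..b} s))"
  proof (intro P.Fubini_integral integrableI_bounded_set[where B = "1 / e"])
    show "emeasure (M \<Otimes>\<^sub>M lborel) (space M \<times> {a..b}) < \<infinity>"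
      by (subst lborel.emeasure_pair_measure_Times)
         (use \<open>a \<le> b\<close> in \<open>auto simp: ennreal_mult_less_top emeasure_eq_measure\<close>)
    show "AE x\<in>space M \<times> {a..b} in M \<Otimes>\<^sub>M lborel.
        norm (case x of (x, s) \<Rightarrow> e / ((x - s)\<^sup>2 + e\<^sup>2) * indicator {a..b} s) \<le> 1 / e"
      using b by (intro AE_I2) (auto split: split_indicator)
    show "AE x in M \<Otimes>\<^sub>M lborel. x \<notin> space M \<times> {a..b} \<longrightarrow>
        (case x of (x, s) \<Rightarrow> e / ((x - s)\<^sup>2 + e\<^sup>2) * indicator {a..b} s) = 0"
      by (intro AE_I2) (auto simp: space_pair_measure indicator_eq_0_iff)
  qed auto
  finally show ?thesis
    unfolding poisson_kernel_integral[OF \<open>a \<le> b\<close> \<open>e > 0\<close>] .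
qed

text \<open>The arguments are those of the integrated Poisson kernel for height 1/n^2 and the
  interval from a + 1/n to n. At \<open>x = a\<close> the second argument equals n for n > 0, so
  both terms tend to pi/2 and the endpoint is excluded from the indicator.\<close>

lemma arctan_difference_tendsto_indicator:
  fixes a x :: real
  shows "(\<lambda>n. arctan ((real n - x) * (real n)\<^sup>2) - arctan ((a + 1 / real n - x) * (real n)\<^sup>2))
    \<longlonglongrightarrow> pi * indicator {a<..} x"
proof -
  have 1: "(\<lambda>n. arctan ((real n - x) * (real n)\<^sup>2)) \<longlonglongrightarrow> pi / 2"
    by (rule filterlim_compose[OF tendsto_arctan_at_top]) real_asymp
  have 2: "(\<lambda>n. arctan ((a + 1 / real n - x) * (real n)\<^sup>2)) \<longlonglongrightarrow> (if x \<le> a then pi / 2 else - (pi / 2))"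
  proof (cases "x \<le> a")
    case True
    have "filterlim (\<lambda>n. (a + 1 / real n - x) * (real n)\<^sup>2) at_top sequentially"
    proof (rule filterlim_at_top_mono[OF filterlim_real_sequentially])
      show "\<forall>\<^sub>F n in sequentially. real n \<le> (a + 1 / real n - x) * (real n)\<^sup>2"
        using eventually_gt_at_top[of 0]
      proof eventually_elim
        case (elim n)
        have "(a + 1 / real n - x) * (real n)\<^sup>2 = (a - x) * (real n)\<^sup>2 + real n"
          using elim by (simp add: field_simps power2_eq_square)
        then show ?case using True by simp
      qed
    qed
    then show ?thesis using True by (auto intro: filterlim_compose[OF tendsto_arctan_at_top])
  next
    case False
    then have "a - x < 0" by simp
    then have "filterlim (\<lambda>n. (a + 1 / real n - x) * (real n)\<^sup>2) at_bot sequentially"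
      by real_asymp
    then show ?thesis using False by (auto intro: filterlim_compose[OF tendsto_arctan_at_bot])
  qed
  have "pi / 2 - (if x \<le> a then pi / 2 else - (pi / 2)) = pi * indicator {a<..} x"
    by simp
  with tendsto_diff[OF 1 2] show ?thesis by metis
qed

text \<open>The height \<open>1/n\<^sup>2\<close> shrinks faster than the gap \<open>1/n\<close>, so an atom of \<open>M\<close> at \<open>a\<close> contributes
  nothing in the limit.\<close>

lemma stieltjes_inversion:
  assumes fin: "finite_measure M" and sets: "sets M = sets borel"
  shows "(\<lambda>n. LBINT s. Im (stieltjes M (Complex s (1 / (real n)\<^sup>2))) * indicator {a + 1 / real n..real n} s)
    \<longlonglongrightarrow> pi * measure M {a<..}"
proof -
  note sets[measurable_cong]
  have "(\<lambda>n. LINT x|M. arctan ((real n - x) * (real n)\<^sup>2) - arctan ((a + 1 / real n - x) * (real n)\<^sup>2))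
    \<longlonglongrightarrow> (LINT x|M. pi * indicator {a<..} x)"
  proof (rule integral_dominated_convergence[where w = "\<lambda>_. pi"])
    show "AE x in M. norm (arctan ((real n - x) * (real n)\<^sup>2) - arctan ((a + 1 / real n - x) * (real n)\<^sup>2)) \<le> pi" for n
    proof (rule AE_I2)
      fix x
      show "norm (arctan ((real n - x) * (real n)\<^sup>2) - arctan ((a + 1 / real n - x) * (real n)\<^sup>2)) \<le> pi"
        using arctan_bounded[of "(real n - x) * (real n)\<^sup>2"] arctan_bounded[of "(a + 1 / real n - x) * (real n)\<^sup>2"]
        unfolding real_norm_def by linarith
    qed
    show "integrable M (\<lambda>_. pi)" using fin by (simp add: finite_measure.integrable_const)
  qed (use arctan_difference_tendsto_indicator in auto)
  also have "(LINT x|M. pi * indicator {a<..} x) = pi * measure M {a<..}"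
    using sets_eq_imp_space_eq[OF sets] by simp
  finally show ?thesis
  proof (rule Lim_transform_eventually)
    have "\<forall>\<^sub>F n in sequentially. a + 1 / real n \<le> real n" by real_asymp
    then show "\<forall>\<^sub>F n in sequentially.
        (LINT x|M. arctan ((real n - x) * (real n)\<^sup>2) - arctan ((a + 1 / real n - x) * (real n)\<^sup>2))
      = (LBINT s. Im (stieltjes M (Complex s (1 / (real n)\<^sup>2))) * indicator {a + 1 / real n..real n} s)"
      using eventually_gt_at_top[of 0]
    proof eventually_elim
      case (elim n)
      then have "1 / (real n)\<^sup>2 > 0" by simp
      from integral_Im_stieltjes[OF fin sets this elim(1)] show ?case by simp
    qed
  qed
qed

text \<open>Inversion recovers the mass of every open right half-line, and these masses determine a
  finite Borel measure on the line.\<close>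

lemma stieltjes_eq_imp_measure_eq:
  assumes M: "finite_measure M" "sets M = sets borel"
    and N: "finite_measure N" "sets N = sets borel"
    and eq: "\<And>z. Im z > 0 \<Longrightarrow> stieltjes M z = stieltjes N z"
  shows "M = N"
proof (rule measure_eqI_lessThan)
  fix a :: real
  interpret M: finite_measure M by fact
  interpret N: finite_measure N by fact
  let ?I = "\<lambda>M n. LBINT s. Im (stieltjes M (Complex s (1 / (real n)\<^sup>2))) * indicator {a + 1 / real n..real n} s"
  \<comment> \<open>For n = 0 the height \<open>1 / 0\<close> evaluates to 0, so \<open>eq\<close>
    applies only from n = 1 on.\<close>
  have "\<forall>\<^sub>F n in sequentially. ?I N n = ?I M n"
    using eventually_gt_at_top[of 0] by eventually_elim (simp add: eq)
  then have "?I M \<longlonglongrightarrow> pi * measure N {a<..}"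
    using stieltjes_inversion[OF N] by (rule Lim_transform_eventually[rotated])
  then have "pi * measure M {a<..} = pi * measure N {a<..}"
    using stieltjes_inversion[OF M] LIMSEQ_unique by blast
  then show "emeasure M {a<..} = emeasure N {a<..}"
    by (simp add: M.emeasure_eq_measure N.emeasure_eq_measure)
  show "emeasure M {a<..} < \<infinity>" by (simp add: M.emeasure_eq_measure)
qed (fact M N)+

section \<open>Root reflection and coefficient estimates for polynomials\<close>

lemma poly_reflect_roots:
  fixes p :: "complex poly"
  obtains q where "\<And>x. norm (poly q (complex_of_real x)) = norm (poly p (complex_of_real x))"
    and "\<And>x y Y. \<bar>y\<bar> \<le> Y \<Longrightarrow> norm (poly p (Complex x y)) \<le> norm (poly q (Complex x Y))"
proof (cases "p = 0")
  case True
  then show ?thesis using that[of 0] by simp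
next
  case False
  \<comment> \<open>\<open>r\<close> moves every root into the closed lower half-plane. A root and
    its image are equally far from each real point, while the vertical distance from height
    \<open>Y\<close> to the image is \<open>Y + \<bar>Im w\<bar>\<close>, at least
    \<open>\<bar>y - Im w\<bar>\<close> when \<open>\<bar>y\<bar> \<le> Y\<close>.\<close>
  define r where "r w = Complex (Re w) (- \<bar>Im w\<bar>)" for w
  from alg_closed_imp_factorization[OF False]
  obtain A where p: "p = smult (lead_coeff p) (\<Prod>w\<in>#A. [:- w, 1:])" by blast
  define q where "q = smult (lead_coeff p) (\<Prod>w\<in>#A. [:- r w, 1:])"
  have real: "norm (poly (\<Prod>w\<in>#A. [:- r w, 1:]) (complex_of_real x)) = norm (poly (\<Prod>w\<in>#A. [:- w, 1:]) (complex_of_real x))" for x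
  proof (induction A)
    case (add w A)
    have "norm (complex_of_real x - r w) = norm (complex_of_real x - w)"
      by (simp add: r_def cmod_def)
    with add show ?case by (simp add: norm_mult del: mult_pCons_left)
  qed simp
  have upper: "norm (poly (\<Prod>w\<in>#A. [:- w, 1:]) (Complex x y)) \<le> norm (poly (\<Prod>w\<in>#A. [:- r w, 1:]) (Complex x Y))"
    if "\<bar>y\<bar> \<le> Y" for x y Y
  proof (induction A)
    case (add w A)
    have "\<bar>y - Im w\<bar> \<le> \<bar>Y + \<bar>Im w\<bar>\<bar>" using that by linarith
    then have "norm (Complex x y - w) \<le> norm (Complex x Y - r w)"
      by (simp add: r_def cmod_def abs_le_square_iff)
    with add show ?case by (simp add: norm_mult mult_mono del: mult_pCons_left)
  qed simp
  show ?thesis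
  proof (rule that[of q])
    show "norm (poly q (complex_of_real x)) = norm (poly p (complex_of_real x))" for x
      by (subst p) (simp add: q_def norm_mult real)
    show "norm (poly p (Complex x y)) \<le> norm (poly q (Complex x Y))" if "\<bar>y\<bar> \<le> Y" for x y Y
      by (subst p) (simp add: q_def norm_mult mult_left_mono upper[OF that])
  qed
qed

text \<open>The k-th derivative at 0 is k! times the k-th coefficient, so Cauchy's inequality on the
  circle of radius \<open>R\<close> applies.\<close>

lemma poly_coeff_Cauchy_bound:
  fixes p :: "complex poly"
  assumes "R > 0" and bound: "\<And>z. norm z \<le> R \<Longrightarrow> norm (poly p z) \<le> C"
  shows "norm (coeff p k) \<le> C / R ^ k"
proof -
  have d: "(deriv ^^ k) (poly p) = poly ((pderiv ^^ k) p)" for k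
    by (induction k) (auto simp: poly_DERIV intro!: DERIV_imp_deriv)
  have "(deriv ^^ k) (poly p) 0 = fact k * coeff p k"
    by (simp add: d poly_0_coeff_0 coeff_higher_pderiv pochhammer_fact)
  moreover have "norm ((deriv ^^ k) (poly p) 0) \<le> fact k * C / R ^ k"
    using assms by (intro Cauchy_inequality) (auto intro!: holomorphic_intros continuous_intros)
  ultimately have "fact k * norm (coeff p k) \<le> fact k * (C / R ^ k)"
    by (simp add: norm_mult)
  then show ?thesis by (rule mult_left_le_imp_le) simp
qed

section \<open>Polynomial integrals for measures with equal moments\<close>

lemma moments_all_orders_imp_finite_measure:
  assumes "moments_all_orders M"
  shows "finite_measure M"
proof -
  have "integrable M (\<lambda>x. (norm (poly 1 (complex_of_real x)))\<^sup>2)"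
    using assms unfolding moments_all_orders_def L2_def by blast
  then have "integrable M (\<lambda>x. 1 :: real)" by simp
  then have "(\<integral>\<^sup>+x. ennreal (norm (1 :: real)) \<partial>M) < \<infinity>"
    unfolding integrable_iff_bounded by blast
  then show ?thesis by (intro finite_measureI) simp
qed

lemma integral_poly_eq_of_moments_eq:
  assumes M: "moments_all_orders M" "sets M = sets borel"
    and N: "moments_all_orders N" "sets N = sets borel"
    and eq: "\<And>n. moment M n = moment N n"
  shows "(LINT x|M. poly p (complex_of_real x)) = (LINT x|N. poly p (complex_of_real x))"
proof -
  have *: "(LINT x|M. poly p (complex_of_real x)) = (\<Sum>i\<le>degree p. coeff p i * complex_of_real (moment M i))"
    if M: "moments_all_orders M" "sets M = sets borel" for M
  proof -
    have "integrable M (\<lambda>x. x ^ n)" for n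
      using moments_all_orders_iff_integrable M by (auto simp: borel_measure_on_reals_def)
    then have i: "integrable M (\<lambda>x. complex_of_real (x ^ n))" for n
      by (rule integrable_of_real)
    have "(LINT x|M. poly p (complex_of_real x)) = (LINT x|M. (\<Sum>i\<le>degree p. coeff p i * complex_of_real (x ^ i)))"
      unfolding poly_altdef by simp
    also have "\<dots> = (\<Sum>i\<le>degree p. LINT x|M. coeff p i * complex_of_real (x ^ i))"
      using i by (intro Bochner_Integration.integral_sum integrable_mult_right)
    finally show ?thesis
      by (simp add: moment_def del: of_real_power)
  qed
  show ?thesis using *[OF M] *[OF N] eq by simp
qed

text \<open>On the real axis |p|^2 is itself a polynomial: \<open>p\<close> times the polynomial
  with conjugated coefficients.\<close>

lemma integral_norm_poly_square_eq_of_moments_eq: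
  assumes M: "moments_all_orders M" "sets M = sets borel"
    and N: "moments_all_orders N" "sets N = sets borel"
    and eq: "\<And>n. moment M n = moment N n"
  shows "(LINT x|M. (norm (poly p (complex_of_real x)))\<^sup>2) = (LINT x|N. (norm (poly p (complex_of_real x)))\<^sup>2)"
proof -
  have "complex_of_real ((norm (poly p (complex_of_real x)))\<^sup>2) = poly (p * map_poly cnj p) (complex_of_real x)" for x
    unfolding complex_norm_square by (simp only: poly_mult poly_cnj complex_cnj_complex_of_real)
  then have "(LINT x|M. complex_of_real ((norm (poly p (complex_of_real x)))\<^sup>2))
      = (LINT x|N. complex_of_real ((norm (poly p (complex_of_real x)))\<^sup>2))"
    using integral_poly_eq_of_moments_eq[OF assms] by presburger
  then show ?thesis unfolding integral_complex_of_real of_real_eq_iff .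
qed

text \<open>The elementary t <= 1 + t^2, in place of Cauchy-Schwarz, yields one dominating function
  for both claims; \<open>moment M 0\<close> is the total mass.\<close>

lemma
  assumes M: "moments_all_orders M" "sets M = sets borel" and z: "Im z \<noteq> 0"
  shows poly_stieltjes_kernel_integrable:
      "integrable M (\<lambda>x. poly p (complex_of_real x) * (1 / (complex_of_real x - z)))" (is ?int)
    and norm_integral_poly_stieltjes_kernel_le:
      "norm (LINT x|M. poly p (complex_of_real x) * (1 / (complex_of_real x - z)))
      \<le> (moment M 0 + (LINT x|M. (norm (poly p (complex_of_real x)))\<^sup>2)) / \<bar>Im z\<bar>" (is ?bound)
proof -
  note M(2)[measurable_cong]
  let ?f = "\<lambda>x. poly p (complex_of_real x) * (1 / (complex_of_real x - z))"
  have f [measurable]: "(\<lambda>x. poly p (complex_of_real x)) \<in> borel_measurable M"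
    and sq: "integrable M (\<lambda>x. (norm (poly p (complex_of_real x)))\<^sup>2)"
    using M(1) unfolding moments_all_orders_def L2_def by blast+
  interpret finite_measure M by (rule moments_all_orders_imp_finite_measure[OF M(1)])
  have dom: "norm (?f x) \<le> (1 + (norm (poly p (complex_of_real x)))\<^sup>2) / \<bar>Im z\<bar>" for x
  proof -
    have "t \<le> 1 + t\<^sup>2" for t :: real
      using zero_le_power2[of "t - 1"] zero_le_power2[of t] unfolding power2_diff power_one mult_1_right by linarith
    then have "norm (poly p (complex_of_real x)) * norm (1 / (complex_of_real x - z))
        \<le> (1 + (norm (poly p (complex_of_real x)))\<^sup>2) * (1 / \<bar>Im z\<bar>)"
      by (intro mult_mono stieltjes_kernel_bound[OF z]) auto
    then show ?thesis by (simp add: norm_mult norm_divide)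
  qed
  have i: "integrable M (\<lambda>x. (1 + (norm (poly p (complex_of_real x)))\<^sup>2) / \<bar>Im z\<bar>)"
    using sq by simp
  show int: ?int
    using dom z by (intro Bochner_Integration.integrable_bound[OF i]) (auto intro: order_trans[OF _ abs_ge_self])
  have "norm (LINT x|M. ?f x) \<le> (LINT x|M. norm (?f x))"
    by (rule integral_norm_bound)
  also have "\<dots> \<le> (LINT x|M. (1 + (norm (poly p (complex_of_real x)))\<^sup>2) / \<bar>Im z\<bar>)"
    using dom by (intro integral_mono integrable_norm int i)
  also have "\<dots> = (moment M 0 + (LINT x|M. (norm (poly p (complex_of_real x)))\<^sup>2)) / \<bar>Im z\<bar>"
    using sq by (simp add: moment_def)
  finally show ?bound .
qed

text \<open>Since \<open>(p(x) - p(z)) / (x - z)\<close> is a polynomial in \<open>x\<close>, its integrals against \<open>M\<close> and \<open>N\<close> agree;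
  this isolates \<open>p(z)\<close> times the difference of the Stieltjes transforms.\<close>

lemma norm_poly_times_stieltjes_difference_le:
  assumes M: "moments_all_orders M" "sets M = sets borel"
    and N: "moments_all_orders N" "sets N = sets borel"
    and eq: "\<And>n. moment M n = moment N n" and z: "Im z \<noteq> 0"
  shows "norm (poly p z) * norm (stieltjes M z - stieltjes N z)
    \<le> 2 * (moment M 0 + (LINT x|M. (norm (poly p (complex_of_real x)))\<^sup>2)) / \<bar>Im z\<bar>"
proof -
  let ?J = "\<lambda>M. LINT x|M. poly p (complex_of_real x) * (1 / (complex_of_real x - z))"
  define q where "q = synthetic_div p z"
  have q: "poly q (complex_of_real x)
      = poly p (complex_of_real x) * (1 / (complex_of_real x - z)) - poly p z * (1 / (complex_of_real x - z))" for x
  proof -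
    have "poly p (complex_of_real x) = (complex_of_real x - z) * poly q (complex_of_real x) + poly p z"
      by (subst synthetic_div_correct'[of z p, symmetric]) (simp add: q_def algebra_simps)
    moreover have "complex_of_real x \<noteq> z" using z by auto
    ultimately show ?thesis by (simp add: divide_simps)
  qed
  have int: "(LINT x|M. poly q (complex_of_real x)) = ?J M - poly p z * stieltjes M z"
    if M: "moments_all_orders M" "sets M = sets borel" for M
  proof -
    note i = stieltjes_kernel_integrable[OF moments_all_orders_imp_finite_measure[OF M(1)] M(2) z]
    show ?thesis
      unfolding q stieltjes_def
      by (subst Bochner_Integration.integral_diff)
         (auto simp del: times_divide_eq_right intro!: integrable_mult_right i poly_stieltjes_kernel_integrable[OF M z])
  qed
  have "poly p z * (stieltjes M z - stieltjes N z) = ?J M - ?J N"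
    using int[OF M] int[OF N] integral_poly_eq_of_moments_eq[OF M N eq, of q] by (simp add: algebra_simps)
  then have "norm (poly p z) * norm (stieltjes M z - stieltjes N z) = norm (?J M - ?J N)"
    by (metis norm_mult)
  also have "\<dots> \<le> norm (?J M) + norm (?J N)" by (rule norm_triangle_ineq4)
  \<comment> \<open>The mass and the norm of \<open>p\<close> are the same for \<open>N\<close> as
    for \<open>M\<close>, so both integrals have the same bound, whence the factor 2.\<close>
  also have "\<dots> \<le> 2 * (moment M 0 + (LINT x|M. (norm (poly p (complex_of_real x)))\<^sup>2)) / \<bar>Im z\<bar>"
    using norm_integral_poly_stieltjes_kernel_le[OF M z, of p] norm_integral_poly_stieltjes_kernel_le[OF N z, of p]
    unfolding integral_norm_poly_square_eq_of_moments_eq[OF M N eq, symmetric] eq[symmetric]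
    by (simp add: add_divide_distrib)
  finally show ?thesis .
qed

section \<open>Locally uniform bounds for point evaluations\<close>

lemma holomorphic_upper_half_plane_nonvanishing_line:
  assumes hol: "f holomorphic_on {z. Im z > 0}" and z0: "Im z0 > 0" "f z0 \<noteq> 0"
  obtains Y where "Y > R" "Y > 0" "\<And>x. f (Complex x Y) \<noteq> 0"
proof -
  let ?H = "{z. Im z > 0}"
  \<comment> \<open>The theorem on countable zero sets asks for an F-sigma domain; closed
    half-planes exhaust the open one.\<close>
  have "fsigma (\<Union>n. {z. inverse (real (Suc n)) \<le> Im z})"
    by (intro fsigma.intros closed_halfspace_Im_ge)
  moreover have "(\<Union>n. {z. inverse (real (Suc n)) \<le> Im z}) = ?H"
  proof (intro equalityI subsetI)
    fix z assume "z \<in> ?H"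
    then obtain n where "inverse (real (Suc n)) < Im z" using reals_Archimedean by blast
    then show "z \<in> (\<Union>n. {z. inverse (real (Suc n)) \<le> Im z})" by (auto intro: less_imp_le)
  next
    fix z assume "z \<in> (\<Union>n. {z. inverse (real (Suc n)) \<le> Im z})"
    then obtain n where "inverse (real (Suc n)) \<le> Im z" by blast
    moreover have "inverse (real (Suc n)) > 0" by simp
    ultimately show "z \<in> ?H" by (simp only: mem_Collect_eq order.strict_trans2)
  qed
  ultimately have "fsigma ?H" by simp
  \<comment> \<open>A constant \<open>f\<close> has the nonzero value \<open>f z0\<close> and hence
    no zeros; otherwise the zeros are isolated.\<close>
  have "countable {z\<in>?H. f z = 0}"
  proof (cases "f constant_on ?H")
    case True
    then have "{z\<in>?H. f z = 0} = {}" using z0 unfolding constant_on_def by auto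
    then show ?thesis by (metis countable_empty)
  next
    case False
    then show ?thesis
      using hol by (intro holomorphic_countable_zeros)
        (auto simp: open_halfspace_Im_gt convex_halfspace_Im_gt convex_connected \<open>fsigma ?H\<close>)
  qed
  \<comment> \<open>Zeros occur at countably many heights only, whereas the candidate heights form
    an uncountable interval; its left end \<open>max 0 R\<close> secures both bounds on
    \<open>Y\<close>.\<close>
  then have "countable (Im ` {z\<in>?H. f z = 0})" by (rule countable_image)
  moreover have "uncountable {max 0 R<..<max 0 R + 1}" by (simp add: uncountable_open_interval)
  ultimately obtain Y where "Y \<in> {max 0 R<..<max 0 R + 1}" "Y \<notin> Im ` {z\<in>?H. f z = 0}"
    by (meson countable_subset subsetI)
  then show ?thesis by (intro that[of Y]) (force simp: image_iff)+
qed

text \<open>Indeterminacy enters the argument only here. The constant is uniform in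
  \<open>p\<close>: it is read off a segment on which \<open>D\<close> is bounded away from 0, and
  root reflection carries it to the disc.\<close>

lemma indeterminate_point_evaluations_bounded:
  assumes M: "moments_all_orders M" "sets M = sets borel" and ind: "indeterminate M"
  obtains C where "\<And>p z. (LINT x|M. (norm (poly p (complex_of_real x)))\<^sup>2) \<le> B \<Longrightarrow> norm z \<le> R \<Longrightarrow> norm (poly p z) \<le> C"
proof -
  from ind obtain N where N: "sets N = sets borel"
    and mom: "\<And>n. has_bochner_integral N (\<lambda>x. x ^ n) (moment M n)" and "N \<noteq> M"
    unfolding indeterminate_def determinate_def borel_measure_on_reals_def by blast
  have eq: "moment M n = moment N n" for n
    using mom[of n] by (simp add: moment_def has_bochner_integral_integral_eq)
  have N': "moments_all_orders N"
    using mom N by (subst moments_all_orders_iff_integrable) (auto simp: borel_measure_on_reals_def has_bochner_integral_iff)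
  note fin = moments_all_orders_imp_finite_measure[OF M(1)] moments_all_orders_imp_finite_measure[OF N']
  define D where "D z = stieltjes M z - stieltjes N z" for z
  have hol: "D holomorphic_on {z. Im z > 0}"
    unfolding D_def using fin M N
    by (intro holomorphic_on_diff stieltjes_holomorphic_on_upper_half_plane)
  obtain z0 where "Im z0 > 0" "D z0 \<noteq> 0"
    using stieltjes_eq_imp_measure_eq[OF fin(1) M(2) fin(2) N] \<open>N \<noteq> M\<close> unfolding D_def by fastforce
  then obtain Y where Y: "Y > R" "Y > 0" and nz: "\<And>x. D (Complex x Y) \<noteq> 0"
    using holomorphic_upper_half_plane_nonvanishing_line[OF hol] by blast
  \<comment> \<open>The segment at height \<open>Y\<close> above the real parts occurring in the
    disc; the absolute values keep it nonempty for negative \<open>R\<close>.\<close>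
  define K where "K = (\<lambda>x. Complex x Y) ` {-\<bar>R\<bar>..\<bar>R\<bar>}"
  have "compact K" unfolding K_def Complex_eq
    by (intro compact_continuous_image continuous_intros) auto
  moreover have "continuous_on K (\<lambda>z. norm (D z))"
    by (intro continuous_intros continuous_on_subset[OF holomorphic_on_imp_continuous_on[OF hol]])
       (use Y in \<open>auto simp: K_def\<close>)
  moreover have "K \<noteq> {}" by (simp add: K_def)
  ultimately obtain w where w: "w \<in> K" "\<And>z. z \<in> K \<Longrightarrow> norm (D w) \<le> norm (D z)"
    using continuous_attains_inf[of K "\<lambda>z. norm (D z)"] by auto
  define m where "m = norm (D w)"
  obtain x0 where "w = Complex x0 Y" using w(1) unfolding K_def by blast
  with nz have m: "m > 0" unfolding m_def zero_less_norm_iff by (simp only: not_False_eq_True)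
  \<comment> \<open>This solves the estimate for \<open>norm (poly q u) * m\<close> below for the
    norm, \<open>m\<close> being the minimum of |D| on \<open>K\<close>.\<close>
  define C where "C = 2 * (moment M 0 + B) / Y / m"
  show ?thesis
  proof (rule that[of C])
    fix p and z :: complex assume B: "(LINT x|M. (norm (poly p (complex_of_real x)))\<^sup>2) \<le> B" and z: "norm z \<le> R"
    obtain q where q: "\<And>x. norm (poly q (complex_of_real x)) = norm (poly p (complex_of_real x))"
      "\<And>x y Y. \<bar>y\<bar> \<le> Y \<Longrightarrow> norm (poly p (Complex x y)) \<le> norm (poly q (Complex x Y))"
      using poly_reflect_roots by blast
    \<comment> \<open>\<open>u\<close> has the real part of \<open>z\<close>, and |Im z| <= R < Y,
      so reflection compares \<open>p\<close> at \<open>z\<close> with \<open>q\<close> at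
      \<open>u\<close>.\<close>
    define u where "u = Complex (Re z) Y"
    have "\<bar>Im z\<bar> \<le> Y" using abs_Im_le_cmod[of z] z Y by linarith
    then have "norm (poly p z) \<le> norm (poly q u)"
      using q(2)[of "Im z" Y "Re z"] by (simp add: u_def)
    also have "norm (poly q u) * m \<le> 2 * (moment M 0 + B) / Y"
    proof -
      have "u \<in> K" unfolding K_def u_def
        using abs_Re_le_cmod[of z] z by (intro imageI) auto
      then have "norm (poly q u) * m \<le> norm (poly q u) * norm (D u)"
        using w(2) by (intro mult_left_mono) (auto simp: m_def)
      also have "\<dots> \<le> 2 * (moment M 0 + (LINT x|M. (norm (poly q (complex_of_real x)))\<^sup>2)) / \<bar>Im u\<bar>"
        unfolding D_def using Y by (intro norm_poly_times_stieltjes_difference_le M N N' eq) (simp add: u_def)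
      also have "\<dots> \<le> 2 * (moment M 0 + B) / Y"
        using B Y unfolding q(1) u_def by (auto intro!: divide_right_mono)
      finally show ?thesis .
    qed
    then have "norm (poly q u) \<le> C" using m unfolding C_def by (simp only: pos_le_divide_eq)
    finally show "norm (poly p z) \<le> C" .
  qed
qed

section \<open>Pointwise limits and Fatou's lemma\<close>

lemma poly_tendsto_0_of_coeff_tendsto_0:
  fixes P :: "nat \<Rightarrow> complex poly"
  assumes coeff: "\<And>k. (\<lambda>n. coeff (P n) k) \<longlonglongrightarrow> 0"
    and bound: "\<And>n z. norm z \<le> R \<Longrightarrow> norm (poly (P n) z) \<le> C" and z: "norm z < R"
  shows "(\<lambda>n. poly (P n) z) \<longlonglongrightarrow> 0"
proof -
  have R: "R > 0" using z norm_ge_zero[of z] by linarith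
  have "(\<lambda>n. \<Sum>k. coeff (P n) k * z ^ k) \<longlonglongrightarrow> (\<Sum>k. 0 :: complex)"
  proof (rule tannerys_theorem[THEN conjunct2, THEN conjunct2])
    show "(\<lambda>n. coeff (P n) k * z ^ k) \<longlonglongrightarrow> 0" for k
      using coeff by (intro tendsto_mult_left_zero)
    \<comment> \<open>Cauchy's estimate gives a geometric majorant independent of \<open>n\<close>,
      convergent since |z| < R; this permits exchanging limit and sum.\<close>
    have *: "norm (coeff (P n) k * z ^ k) \<le> C * (norm z / R) ^ k" for n k
    proof -
      have "norm (coeff (P n) k) * norm z ^ k \<le> C / R ^ k * norm z ^ k"
        by (intro mult_right_mono poly_coeff_Cauchy_bound R bound) auto
      then show ?thesis by (simp add: norm_mult norm_power power_divide)
    qed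
    show "\<forall>\<^sub>F (k, n) in at_top \<times>\<^sub>F sequentially. norm (coeff (P n) k * z ^ k) \<le> C * (norm z / R) ^ k"
      by (rule always_eventually) (use * in auto)
    show "summable (\<lambda>k. C * (norm z / R) ^ k)"
      using z R by (intro summable_mult summable_geometric) auto
  qed simp
  moreover have "(\<Sum>k. coeff (P n) k * z ^ k) = poly (P n) z" for n
    unfolding poly_altdef by (rule suminf_finite) (auto simp: coeff_eq_0)
  ultimately show ?thesis by simp
qed

text \<open>Since \<open>u n\<close> tends to 0 pointwise, |u n - f|^2 tends to |f|^2, and Fatou
  bounds the integral of |f|^2 by the limit 0.\<close>

lemma AE_eq_0_of_L2_tendsto_of_tendsto_0:
  fixes u :: "nat \<Rightarrow> 'a \<Rightarrow> 'b :: {banach, second_countable_topology}"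
  assumes f [measurable]: "f \<in> borel_measurable M" and u [measurable]: "\<And>n. u n \<in> borel_measurable M"
    and sq: "\<And>n. integrable M (\<lambda>x. (norm (u n x - f x))\<^sup>2)"
    and L2: "(\<lambda>n. LINT x|M. (norm (u n x - f x))\<^sup>2) \<longlonglongrightarrow> 0"
    and pw: "\<And>x. x \<in> space M \<Longrightarrow> (\<lambda>n. u n x) \<longlonglongrightarrow> 0"
  shows "AE x in M. f x = 0"
proof -
  have lim: "liminf (\<lambda>n. ennreal ((norm (u n x - f x))\<^sup>2)) = ennreal ((norm (f x))\<^sup>2)" if "x \<in> space M" for x
  proof -
    have "(\<lambda>n. (norm (u n x - f x))\<^sup>2) \<longlonglongrightarrow> (norm (0 - f x))\<^sup>2"
      by (intro tendsto_intros pw that)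
    then show ?thesis
      by (intro lim_imp_Liminf tendsto_ennrealI) auto
  qed
  have "(\<integral>\<^sup>+x. ennreal ((norm (f x))\<^sup>2) \<partial>M) = (\<integral>\<^sup>+x. liminf (\<lambda>n. ennreal ((norm (u n x - f x))\<^sup>2)) \<partial>M)"
    by (intro nn_integral_cong) (simp add: lim)
  also have "\<dots> \<le> liminf (\<lambda>n. \<integral>\<^sup>+x. ennreal ((norm (u n x - f x))\<^sup>2) \<partial>M)"
    by (intro nn_integral_liminf) measurable
  also have "\<dots> = liminf (\<lambda>n. ennreal (LINT x|M. (norm (u n x - f x))\<^sup>2))"
    by (simp add: nn_integral_eq_integral sq)
  also have "\<dots> = ennreal 0"
    using L2 by (intro lim_imp_Liminf tendsto_ennrealI) auto
  finally have "(\<integral>\<^sup>+x. ennreal ((norm (f x))\<^sup>2) \<partial>M) = 0" by simp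
  then have "AE x in M. ennreal ((norm (f x))\<^sup>2) = 0"
    by (subst (asm) nn_integral_0_iff_AE) auto
  then show ?thesis by eventually_elim simp
qed

section \<open>Closability\<close>

lemma norm_le_ell2_norm:
  assumes "g \<in> fin_seqs"
  shows "norm (g k) \<le> ell2_norm g"
proof -
  have "summable (\<lambda>n. (norm (g n))\<^sup>2)" using assms fin_seqs_subset_ell2 by (auto simp: ell2_def)
  then have "(\<Sum>n\<in>{k}. (norm (g n))\<^sup>2) \<le> (\<Sum>n. (norm (g n))\<^sup>2)"
    by (rule sum_le_suminf) auto
  then show ?thesis unfolding ell2_norm_def by (simp add: real_le_rsqrt)
qed

theorem theorem1p3:
  fixes M :: "real measure"
  assumes "borel_measure_on_reals M"
    and "moments_all_orders M"
    and "indeterminate M"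
  shows "closable fin_seqs M power_series_op"
  unfolding closable_def
proof (intro allI impI, elim conjE)
  fix g :: "nat \<Rightarrow> nat \<Rightarrow> complex" and f
  assume g: "\<forall>k. g k \<in> fin_seqs" and f: "f \<in> L2 M"
    and g0: "(\<lambda>k. ell2_norm (g k)) \<longlonglongrightarrow> 0"
    and conv: "(\<lambda>k. L2_norm M (\<lambda>x. power_series_op (g k) x - f x)) \<longlonglongrightarrow> 0"
  have sets: "sets M = sets borel" using assms(1) by (simp add: borel_measure_on_reals_def)
  define P where "P n = Abs_poly (g n)" for n
  have coeff: "coeff (P n) k = g n k" for n k
    unfolding P_def using g by (subst Abs_poly_inverse) (auto simp: fin_seqs_def MOST_iff_cofinite)
  have op: "power_series_op (g n) = (\<lambda>x. poly (P n) (complex_of_real x))" for n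
    unfolding P_def using power_series_op_eq_poly g by blast
  have meas [measurable]: "(\<lambda>x. poly (P n) (complex_of_real x)) \<in> borel_measurable M" "f \<in> borel_measurable M"
    and int: "integrable M (\<lambda>x. (norm (poly (P n) (complex_of_real x)))\<^sup>2)" "integrable M (\<lambda>x. (norm (f x))\<^sup>2)" for n
    using assms(2) f by (auto simp: moments_all_orders_def L2_def)
  have par: "(norm (a + b))\<^sup>2 \<le> 2 * ((norm a)\<^sup>2 + (norm b)\<^sup>2)" for a b :: complex
  proof -
    have "(norm (a + b))\<^sup>2 \<le> (norm a + norm b)\<^sup>2" by (intro power_mono norm_triangle_ineq) auto
    also have "\<dots> \<le> 2 * ((norm a)\<^sup>2 + (norm b)\<^sup>2)"
      using zero_le_power2[of "norm a - norm b"] by (simp add: power2_sum power2_diff)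
    finally show ?thesis .
  qed
  \<comment> \<open>A Bochner integral defaults to 0 for non-integrable functions, so
    \<open>conv\<close> has its intended meaning only with this fact.\<close>
  have intd: "integrable M (\<lambda>x. (norm (poly (P n) (complex_of_real x) - f x))\<^sup>2)" for n
  proof (rule Bochner_Integration.integrable_bound)
    show "integrable M (\<lambda>x. 2 * ((norm (poly (P n) (complex_of_real x)))\<^sup>2 + (norm (f x))\<^sup>2))"
      using int by simp
    show "AE x in M. norm ((norm (poly (P n) (complex_of_real x) - f x))\<^sup>2)
        \<le> norm (2 * ((norm (poly (P n) (complex_of_real x)))\<^sup>2 + (norm (f x))\<^sup>2))"
    proof (rule AE_I2)
      fix x show "norm ((norm (poly (P n) (complex_of_real x) - f x))\<^sup>2)
        \<le> norm (2 * ((norm (poly (P n) (complex_of_real x)))\<^sup>2 + (norm (f x))\<^sup>2))"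
      using par[of "poly (P n) (complex_of_real x)" "- f x"] by simp
    qed
  qed measurable
  have L2: "(\<lambda>n. LINT x|M. (norm (poly (P n) (complex_of_real x) - f x))\<^sup>2) \<longlonglongrightarrow> 0"
  proof -
    have "(\<lambda>n. (L2_norm M (\<lambda>x. power_series_op (g n) x - f x))\<^sup>2) \<longlonglongrightarrow> 0\<^sup>2"
      by (intro tendsto_power conv)
    then show ?thesis by (simp add: L2_norm_def op)
  qed
  then have "Bseq (\<lambda>n. LINT x|M. (norm (poly (P n) (complex_of_real x) - f x))\<^sup>2)"
    by (intro convergent_imp_Bseq convergentI)
  then obtain B where B: "\<And>n. (LINT x|M. (norm (poly (P n) (complex_of_real x) - f x))\<^sup>2) \<le> B"
    unfolding Bseq_def by (auto dest: abs_le_D1)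
  \<comment> \<open>Obtained by integrating |p|^2 <= 2 (|p - f|^2 + |f|^2).\<close>
  define B' where "B' = 2 * (B + (LINT x|M. (norm (f x))\<^sup>2))"
  have B': "(LINT x|M. (norm (poly (P n) (complex_of_real x)))\<^sup>2) \<le> B'" for n
  proof -
    have "(LINT x|M. (norm (poly (P n) (complex_of_real x)))\<^sup>2)
        \<le> (LINT x|M. 2 * ((norm (poly (P n) (complex_of_real x) - f x))\<^sup>2 + (norm (f x))\<^sup>2))"
    proof (rule integral_mono)
      fix x
      show "(norm (poly (P n) (complex_of_real x)))\<^sup>2
        \<le> 2 * ((norm (poly (P n) (complex_of_real x) - f x))\<^sup>2 + (norm (f x))\<^sup>2)"
        using par[of "poly (P n) (complex_of_real x) - f x" "f x"] by simp
    qed (use int intd in simp_all)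
    also have "\<dots> \<le> B'" using B[of n] int intd by (simp add: B'_def)
    finally show ?thesis .
  qed
  have "(\<lambda>n. poly (P n) (complex_of_real x)) \<longlonglongrightarrow> 0" for x
  proof -
    \<comment> \<open>The radius \<open>\<bar>x\<bar> + 1\<close> puts \<open>x\<close> strictly
      inside the disc, as the geometric majorant requires.\<close>
    obtain C where C: "\<And>p z. (LINT x|M. (norm (poly p (complex_of_real x)))\<^sup>2) \<le> B' \<Longrightarrow> norm z \<le> \<bar>x\<bar> + 1 \<Longrightarrow> norm (poly p z) \<le> C"
      using indeterminate_point_evaluations_bounded[OF assms(2) sets assms(3), of B' "\<bar>x\<bar> + 1"] by metis
    show ?thesis
    proof (rule poly_tendsto_0_of_coeff_tendsto_0)
      show "(\<lambda>n. coeff (P n) k) \<longlonglongrightarrow> 0" for k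
        by (rule Lim_null_comparison[OF _ g0]) (use norm_le_ell2_norm g in \<open>simp add: coeff\<close>)
      show "norm (poly (P n) z) \<le> C" if "norm z \<le> \<bar>x\<bar> + 1" for n z
        by (intro C B' that)
    qed simp
  qed
  then show "AE x in M. f x = 0"
    by (rule AE_eq_0_of_L2_tendsto_of_tendsto_0[OF meas(2) meas(1) intd L2])
qed

end
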